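(* Let $\ell$ and $m$ be positive integers with $2\le\ell<m$, let $G$ be a torsion-free group (not necessarily abelian), written multiplicatively with identity $1$, and let $\mathcal{A}=(A_1,\dots,A_m)$ be a sequence of finite subsets of $G$ with $|A_i|\ge2$ for each $i\in[1,m]$. Let $A=A_1\cup\cdots\cup A_m$. Assume that $\mu_{\mathcal{A}}(a)=\ell$ for some $a\in A$, that $|\{a\in A:\mu_{\mathcal{A}}(a)\ge2\}|\ge2$, and that \[ |\Pi^{\ell}(\mathcal{A})|=\sum_{a\in A}\mu_{\mathcal{A}}(a)-\ell+1 . \] For $j\in[1,\ell]$ let $A'_j=\{a\in A:\mu_{\mathcal{A}}(a)\ge j\}$, and let $k$ be the largest integer such that $|A'_j|\ge2$ for each $j\in[1,k]$. Then there exist $g\in G$ with $g\ne1$ and $\alpha_j,\beta_j\in G$ such that for each $j\in[1,k]$ the set $A'_j$ is a geometric progression of type $(\alpha_j,g,\beta_j)$, and $\alpha_{j+1}=\beta_j^{-1}$ for each $j\in[1,k-1]$.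
   Context: $\chi_S$ is the indicator function of $S$; $\mu_{\mathcal{A}}(a)=\min\big(\ell,\sum_{j=1}^m\chi_{A_j}(a)\big)$ for $a\in A$. $\Pi^{\ell}(\mathcal{A})$ is the set of all products $a_{i_1}\cdots a_{i_\ell}$ with $i_1,\dots,i_\ell\in[1,m]$ pairwise distinct (in any order) and $a_{i_j}\in A_{i_j}$. A nonempty finite set $B\subseteq G$ is a geometric progression of type $(a,g,b)$ ($a,b,g\in G$, $g\neq1$) if $B=\{ab,agb,\dots,ag^{|B|-1}b\}$. *)

theory Defs
  imports "HOL-Algebra.Group"
begin

definition torsion_free :: "('a, 'b) monoid_scheme \<Rightarrow> bool" where
  "torsion_free G \<longleftrightarrow> (\<forall>x\<in>carrier G. x \<noteq> \<one>\<^bsub>G\<^esub> \<longrightarrow> (\<forall>n::nat. n > 0 \<longrightarrow> x [^]\<^bsub>G\<^esub> n \<noteq> \<one>\<^bsub>G\<^esub>))"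

definition union_fam :: "(nat \<Rightarrow> 'a set) \<Rightarrow> nat \<Rightarrow> 'a set" where
  "union_fam A m = (\<Union>i\<in>{1..m}. A i)"

definition mult_fam :: "nat \<Rightarrow> (nat \<Rightarrow> 'a set) \<Rightarrow> nat \<Rightarrow> 'a \<Rightarrow> nat" where
  "mult_fam l A m a = min l (card {i\<in>{1..m}. a \<in> A i})"

definition list_prod :: "('a, 'b) monoid_scheme \<Rightarrow> 'a list \<Rightarrow> 'a" where
  "list_prod G xs = foldr (\<lambda>x y. x \<otimes>\<^bsub>G\<^esub> y) xs \<one>\<^bsub>G\<^esub>"

definition restricted_prod :: "('a, 'b) monoid_scheme \<Rightarrow> nat \<Rightarrow> (nat \<Rightarrow> 'a set) \<Rightarrow> nat \<Rightarrow> 'a set" where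
  "restricted_prod G l A m =
     {list_prod G (map x [0..<l]) | x i. inj_on i {..<l} \<and> i ` {..<l} \<subseteq> {1..m}
                                        \<and> (\<forall>j<l. x j \<in> A (i j))}"

definition geom_prog :: "('a, 'b) monoid_scheme \<Rightarrow> 'a set \<Rightarrow> 'a \<Rightarrow> 'a \<Rightarrow> 'a \<Rightarrow> bool" where
  "geom_prog G B a g b \<longleftrightarrow> finite B \<and> B \<noteq> {} \<and> g \<noteq> \<one>\<^bsub>G\<^esub> \<and>
     B = (\<lambda>n. a \<otimes>\<^bsub>G\<^esub> (g [^]\<^bsub>G\<^esub> n) \<otimes>\<^bsub>G\<^esub> b) ` {..<card B}"

end

theory Submission
  imports Defs "HOL-Algebra.Coset"
begin

text \<open>
  With \<open>A'\<^sub>j = {a. \<mu>(a) \<ge> j}\<close> one has \<open>\<Sum>\<mu>(a) = \<Sum>|A'\<^sub>j|\<close>, and choosing indices greedily gives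
  \<open>A'\<^sub>1 \<cdots> A'\<^sub>l \<subseteq> \<Pi>\<^sup>l(A)\<close>. In a torsion-free group Kemperman's inequality
  \<open>|XY| \<ge> |X| + |Y| - 1\<close> bounds the left side from below by \<open>\<Sum>|A'\<^sub>j| - l + 1\<close>, so the
  hypothesis makes Kemperman's inequality an equality for each pair \<open>A'\<^sub>j, A'\<^sub>j\<^sub>+\<^sub>1\<close>.
  If \<open>|X|, |Y| \<ge> 2\<close>, equality forces progressions (Brailovsky and Freiman). Following Hamidoune,
  take a set \<open>M\<close> of least size \<open>\<ge> 2\<close> with \<open>|MY| = |M| + |Y| - 1\<close>. Distinct left translates of \<open>M\<close>
  share at most one point, and comparing \<open>M\<close> with a set \<open>N\<close> that is extremal for \<open>M\<close> on the
  other side yields \<open>|M| = 2\<close>. Then \<open>|{1,x}Y| = |Y| + 1\<close> for some \<open>x \<noteq> 1\<close>, so \<open>Y\<close> is a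
  progression with ratio \<open>x\<close>; the ratio passes from one factor to the next.
\<close>

section \<open>Sets with at least two elements\<close>

lemma card_ge_2_obtain:
  assumes "2 \<le> card S"
  obtains a b where "a \<in> S" "b \<in> S" "a \<noteq> b"
proof -
  have "finite S" using assms by (metis card.infinite not_numeral_le_zero)
  with assms that show thesis using card_le_Suc0_iff_eq[of S] by fastforce
qed

lemma card_ge_2I:
  assumes "finite S" "a \<in> S" "b \<in> S" "a \<noteq> b"
  shows "2 \<le> card S"
  using assms card_mono[of S "{a, b}"] by auto

section \<open>Torsion-free groups: powers and translations\<close>

locale torsion_free_group = group +
  assumes torsion_free: "torsion_free G"
begin

lemma pow_inj:
  assumes "g \<in> carrier G" "g \<noteq> \<one>"
  shows "inj (\<lambda>n::nat. g [^] n)"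
proof -
  have "i = j" if "i \<le> j" "g [^] i = g [^] j" for i j :: nat
  proof (rule ccontr)
    assume "i \<noteq> j"
    then have "j - i > 0" using that by simp
    moreover have "g [^] (j - i) = \<one>" using pow_eq_div2[OF assms(1)] that(2) by metis
    ultimately show False using torsion_free assms unfolding torsion_free_def by blast
  qed
  then show ?thesis by (metis injI nat_le_linear)
qed

text \<open>Otherwise \<open>g [^] n \<otimes> a\<close>, for a fixed \<open>a\<close> in
  \<open>M\<close>, would run through infinitely many elements of \<open>M\<close>. This excludes
  \<open>M = gM\<close> in the minimality arguments below.\<close>

lemma finite_translation_invariant:
  assumes g: "g \<in> carrier G" and M: "M \<subseteq> carrier G" "finite M" "M \<noteq> {}"
    and sub: "(\<otimes>) g ` M \<subseteq> M"
  shows "g = \<one>"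
proof (rule ccontr)
  assume "g \<noteq> \<one>"
  from M obtain a where a: "a \<in> M" by blast
  then have ac: "a \<in> carrier G" using M by blast
  have pow: "g [^] n \<otimes> a \<in> M" for n :: nat
  proof (induction n)
    case 0
    then show ?case using a ac by simp
  next
    case (Suc n)
    then have "g \<otimes> (g [^] n \<otimes> a) \<in> M" using sub by blast
    then show ?case using g ac by (simp only: nat_pow_Suc2 m_assoc nat_pow_closed)
  qed
  have "inj (\<lambda>n::nat. g [^] n \<otimes> a)"
    using pow_inj[OF g \<open>g \<noteq> \<one>\<close>] g ac by (auto simp: inj_def)
  then have "infinite (range (\<lambda>n::nat. g [^] n \<otimes> a))" by (meson finite_imageD infinite_UNIV_nat)
  moreover have "range (\<lambda>n::nat. g [^] n \<otimes> a) \<subseteq> M" using pow by blast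
  ultimately show False using M(2) finite_subset by blast
qed

section \<open>Product sets and their translates\<close>

lemma set_mult_iff: "x \<in> X <#> Y \<longleftrightarrow> (\<exists>a\<in>X. \<exists>b\<in>Y. x = a \<otimes> b)"
  by (auto simp: set_mult_def)

lemma finite_set_mult: "finite X \<Longrightarrow> finite Y \<Longrightarrow> finite (X <#> Y)"
  by (auto simp: set_mult_def)

lemma set_mult_nonempty: "X \<noteq> {} \<Longrightarrow> Y \<noteq> {} \<Longrightarrow> X <#> Y \<noteq> {}"
  by (auto simp: set_mult_def)

lemma inj_on_l_mult: "g \<in> carrier G \<Longrightarrow> X \<subseteq> carrier G \<Longrightarrow> inj_on ((\<otimes>) g) X"
  by (auto simp: inj_on_def subset_iff)

lemma inj_on_r_mult: "g \<in> carrier G \<Longrightarrow> X \<subseteq> carrier G \<Longrightarrow> inj_on (\<lambda>x. x \<otimes> g) X"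
  by (auto simp: inj_on_def subset_iff)

lemma l_translate_set_mult:
  assumes "g \<in> carrier G" "X \<subseteq> carrier G" "Y \<subseteq> carrier G"
  shows "((\<otimes>) g ` X) <#> Y = (\<otimes>) g ` (X <#> Y)"
proof -
  have "g \<otimes> x \<otimes> y = g \<otimes> (x \<otimes> y)" if "x \<in> X" "y \<in> Y" for x y
    using that assms by (auto intro: m_assoc)
  then show ?thesis by (auto simp: set_mult_def image_iff)
qed

lemma card_l_translate:
  assumes "g \<in> carrier G" "X \<subseteq> carrier G"
  shows "card ((\<otimes>) g ` X) = card X"
  using card_image[OF inj_on_l_mult[OF assms]] .

lemma card_r_translate:
  assumes "g \<in> carrier G" "X \<subseteq> carrier G"
  shows "card ((\<lambda>x. x \<otimes> g) ` X) = card X"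
  using card_image[OF inj_on_r_mult[OF assms]] .

lemma card_le_set_mult:
  assumes "X \<subseteq> carrier G" "Y \<subseteq> carrier G" "finite X" "finite Y" "Y \<noteq> {}"
  shows "card X \<le> card (X <#> Y)"
proof -
  from assms obtain y where y: "y \<in> Y" by blast
  have "card ((\<lambda>x. x \<otimes> y) ` X) \<le> card (X <#> Y)"
    using y assms by (intro card_mono finite_set_mult) (auto simp: set_mult_def)
  then show ?thesis using card_r_translate[of y X] y assms by auto
qed

section \<open>Submodularity and Kemperman's inequality\<close>

text \<open>\<open>(X \<inter> Z)Y\<close> lies in \<open>XY \<inter> ZY\<close>, possibly properly,
  while \<open>(X \<union> Z)Y\<close> is exactly \<open>XY \<union> ZY\<close>.\<close>

lemma card_set_mult_submodular:
  assumes "finite X" "finite Z" "finite Y"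
  shows "card ((X \<inter> Z) <#> Y) + card ((X \<union> Z) <#> Y) \<le> card (X <#> Y) + card (Z <#> Y)"
proof -
  have "(X \<union> Z) <#> Y = (X <#> Y) \<union> (Z <#> Y)" by (auto simp: set_mult_def)
  moreover have "card ((X \<inter> Z) <#> Y) \<le> card ((X <#> Y) \<inter> (Z <#> Y))"
    using assms by (intro card_mono finite_Int disjI1 finite_set_mult) (auto simp: set_mult_def)
  ultimately show ?thesis
    using card_Un_Int[of "X <#> Y" "Z <#> Y"] assms by (simp add: finite_set_mult)
qed

text \<open>
  Let \<open>M\<close> minimise \<open>|XY| - |X|\<close> and have least size among the minimisers. By submodularity \<open>M\<close>
  meets no other left translate of itself; as it meets its translate by \<open>b a\<inverse>\<close> for \<open>a, b \<in> M\<close>,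
  it is a singleton.
\<close>

lemma kemperman:
  assumes X: "X \<subseteq> carrier G" "finite X" "X \<noteq> {}" and Y: "Y \<subseteq> carrier G" "finite Y" "Y \<noteq> {}"
  shows "card X + card Y \<le> card (X <#> Y) + 1"
proof -
  define adm where "adm Z \<longleftrightarrow> Z \<subseteq> carrier G \<and> finite Z \<and> Z \<noteq> {}" for Z
  define f where "f Z = card (Z <#> Y) - card Z" for Z
  \<comment> \<open>The subtraction in \<open>f\<close> never truncates, since
    \<open>|ZY| \<ge> |Z|\<close>.\<close>
  have f: "card (Z <#> Y) = card Z + f Z" if "adm Z" for Z
    using card_le_set_mult[of Z Y] that Y by (simp add: adm_def f_def)
  from X have "adm X" by (simp add: adm_def)
  then obtain M0 where M0: "adm M0" "\<And>Z. adm Z \<Longrightarrow> f M0 \<le> f Z"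
    using ex_has_least_nat[of adm X f] by blast
  define frag where "frag Z \<longleftrightarrow> adm Z \<and> f Z = f M0" for Z
  have "frag M0" using M0 by (simp add: frag_def)
  then obtain M where M: "frag M" "\<And>Z. frag Z \<Longrightarrow> card M \<le> card Z"
    using ex_has_least_nat[of frag M0 card] by blast
  then have Mc: "M \<subseteq> carrier G" "finite M" "M \<noteq> {}" and admM: "adm M"
    by (auto simp: frag_def adm_def)
  have single: "a = b" if ab: "a \<in> M" "b \<in> M" for a b
  proof -
    define g where "g = b \<otimes> inv a"
    have ac: "a \<in> carrier G" "b \<in> carrier G" using ab Mc by auto
    then have g: "g \<in> carrier G" by (simp add: g_def)
    define N where "N = (\<otimes>) g ` M"
    have "g \<otimes> a = b" using ac by (simp add: g_def m_assoc)
    then have bN: "b \<in> N" using ab by (auto simp: N_def)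
    have admN: "adm N" using Mc g by (auto simp: adm_def N_def)
    have cN: "card N = card M" using card_l_translate g Mc by (simp add: N_def)
    have cNY: "card (N <#> Y) = card (M <#> Y)"
      unfolding N_def l_translate_set_mult[OF g Mc(1) Y(1)]
      using card_l_translate[OF g] Mc Y set_mult_closed by simp
    have admI: "adm (M \<inter> N)" and admU: "adm (M \<union> N)"
      using bN ab admM admN by (auto simp: adm_def)
    have "card (M \<inter> N) + card (M \<union> N) = card M + card N"
      using card_Un_Int[of M N] admM admN by (simp add: adm_def)
    moreover have "card ((M \<inter> N) <#> Y) + card ((M \<union> N) <#> Y) \<le> card (M <#> Y) + card (N <#> Y)"
      using card_set_mult_submodular admM admN Y by (simp add: adm_def)
    moreover have "f M = f M0" using M by (simp add: frag_def)
    ultimately have "f (M \<inter> N) + f (M \<union> N) \<le> f M0 + f M0"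
      using f[OF admI] f[OF admU] f[OF admM] f[OF admN] cN cNY by simp
    with M0(2)[OF admI] M0(2)[OF admU] have "f (M \<inter> N) = f M0" by simp
    with admI have "frag (M \<inter> N)" by (simp add: frag_def)
    then have "M \<inter> N = M" using M(2) Mc card_seteq[of M "M \<inter> N"] by auto
    then have "M = N" using cN admN card_subset_eq[of N M] by (auto simp: adm_def)
    then have "g = \<one>" using finite_translation_invariant[OF g Mc] by (simp add: N_def)
    then show ?thesis using \<open>g \<otimes> a = b\<close> ac by simp
  qed
  \<comment> \<open>For a singleton, \<open>f M = |Y| - 1\<close>; as this is the minimum of
    \<open>f\<close>, it bounds \<open>f X\<close> from below.\<close>
  from Mc single obtain a where a: "M = {a}" by blast
  then have "M <#> Y = (\<otimes>) a ` Y" by (auto simp: set_mult_def)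
  then have "card (M <#> Y) = card Y" using card_l_translate a Mc Y by simp
  then have "card Y = 1 + f M" using f[OF admM] a by simp
  also have "f M = f M0" using M by (simp add: frag_def)
  also have "f M0 \<le> f X" using M0 \<open>adm X\<close> by simp
  finally show ?thesis using f[OF \<open>adm X\<close>] by simp
qed

section \<open>Critical pairs and inversion\<close>

text \<open>The equality case of \<open>kemperman\<close>, without singletons: these give equality
  with every finite nonempty partner and carry no information.\<close>

definition critical :: "'a set \<Rightarrow> 'a set \<Rightarrow> bool" where
  "critical X Y \<longleftrightarrow> X \<subseteq> carrier G \<and> Y \<subseteq> carrier G \<and> 2 \<le> card X \<and> 2 \<le> card Y
     \<and> card (X <#> Y) + 1 = card X + card Y"

lemma criticalD:
  assumes "critical X Y"
  shows "X \<subseteq> carrier G" "Y \<subseteq> carrier G" "2 \<le> card X" "2 \<le> card Y" "finite X" "finite Y"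
    "X \<noteq> {}" "Y \<noteq> {}" "card (X <#> Y) + 1 = card X + card Y"
  using assms by (auto simp: critical_def intro: card_ge_0_finite)

lemma inv_set_mult:
  assumes "X \<subseteq> carrier G" "Y \<subseteq> carrier G"
  shows "m_inv G ` (X <#> Y) = (m_inv G ` Y) <#> (m_inv G ` X)"
proof -
  have "inv (x \<otimes> y) = inv y \<otimes> inv x" if "x \<in> X" "y \<in> Y" for x y
    using that assms by (auto intro: inv_mult_group)
  then show ?thesis by (auto simp: set_mult_def image_iff) (metis+)
qed

lemma card_inv_image: "X \<subseteq> carrier G \<Longrightarrow> card (m_inv G ` X) = card X"
  by (intro card_image) (metis inj_onI inv_inv subset_iff)

lemma inv_image_image: "X \<subseteq> carrier G \<Longrightarrow> m_inv G ` m_inv G ` X = X"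
  by (force simp: image_iff)

text \<open>Inversion reverses products, so it exchanges left and right factors and carries results
  about one side to the other.\<close>

lemma critical_inv:
  assumes "critical X Y"
  shows "critical (m_inv G ` Y) (m_inv G ` X)"
  using assms card_inv_image[of "X <#> Y"]
  by (auto simp: critical_def card_inv_image inv_set_mult[symmetric] set_mult_closed)

section \<open>Atoms in the manner of Hamidoune\<close>

definition atom :: "'a set \<Rightarrow> 'a set \<Rightarrow> bool" where
  "atom M Y \<longleftrightarrow> critical M Y \<and> (\<forall>X. critical X Y \<longrightarrow> card M \<le> card X)"

lemma atom_exists: "critical X Y \<Longrightarrow> \<exists>M. atom M Y"
  using ex_has_least_nat[of "\<lambda>X. critical X Y" X card] unfolding atom_def by blast

text \<open>Suppose \<open>M\<close> and \<open>gM\<close> share two points. Submodularity bounds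
  the products of \<open>M \<inter> gM\<close> and \<open>M \<union> gM\<close> with
  \<open>Y\<close> from above, Kemperman bounds each from below, so equality holds for both and the
  intersection is critical. Minimality forces \<open>M = gM\<close>, hence
  \<open>g = \<one>\<close>.\<close>

lemma atom_l_translate:
  assumes M: "atom M Y" and g: "g \<in> carrier G" "g \<noteq> \<one>"
  shows "card (M \<inter> (\<otimes>) g ` M) \<le> 1"
proof (rule ccontr)
  define N where "N = (\<otimes>) g ` M"
  assume "\<not> card (M \<inter> (\<otimes>) g ` M) \<le> 1"
  then have c2: "2 \<le> card (M \<inter> N)" by (simp add: N_def)
  have crit: "critical M Y" using M by (simp add: atom_def)
  note Mc = criticalD[OF crit]
  have Nc: "N \<subseteq> carrier G" "finite N" using Mc g by (auto simp: N_def)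
  have cN: "card N = card M" using card_l_translate g Mc by (simp add: N_def)
  have cNY: "card (N <#> Y) = card (M <#> Y)"
    unfolding N_def l_translate_set_mult[OF g(1) Mc(1,2)]
    using card_l_translate[OF g(1)] Mc set_mult_closed by simp
  have Mn: "M \<inter> N \<noteq> {}" using c2 by auto
  have "card (M \<inter> N) + card (M \<union> N) = card M + card N"
    using card_Un_Int[of M N] Mc Nc by simp
  moreover have "card ((M \<inter> N) <#> Y) + card ((M \<union> N) <#> Y) \<le> card (M <#> Y) + card (N <#> Y)"
    using card_set_mult_submodular Mc Nc by simp
  moreover have "card (M \<inter> N) + card Y \<le> card ((M \<inter> N) <#> Y) + 1"
    using kemperman[of "M \<inter> N" Y] Mc Nc Mn by auto
  moreover have "card (M \<union> N) + card Y \<le> card ((M \<union> N) <#> Y) + 1"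
    using kemperman[of "M \<union> N" Y] Mc Nc Mn by auto
  ultimately have "card ((M \<inter> N) <#> Y) + 1 = card (M \<inter> N) + card Y"
    using Mc(9) cN cNY by linarith
  then have "critical (M \<inter> N) Y" using c2 Mc by (auto simp: critical_def)
  then have "card M \<le> card (M \<inter> N)" using M by (simp add: atom_def)
  then have "M \<inter> N = M" using Mc card_seteq[of M "M \<inter> N"] by auto
  then have "M = N" using cN Nc card_subset_eq[of N M] by auto
  then have "g = \<one>" using finite_translation_invariant[OF g(1) Mc(1,5,7)] by (simp add: N_def)
  then show False using g by simp
qed

text \<open>
  Pairwise small intersections of left translates pass to right translates, because
  \<open>u\<inverse> y = v\<inverse> z\<close> is equivalent to \<open>y z\<inverse> = u v\<inverse>\<close>.
\<close>

lemma atom_r_translate: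
  assumes M: "atom M Y" and bc: "b \<in> carrier G" "c \<in> carrier G" "b \<noteq> c"
  shows "card ((\<lambda>x. x \<otimes> b) ` M \<inter> (\<lambda>x. x \<otimes> c) ` M) \<le> 1"
proof (rule ccontr)
  assume "\<not> ?thesis"
  then have "2 \<le> card ((\<lambda>x. x \<otimes> b) ` M \<inter> (\<lambda>x. x \<otimes> c) ` M)" by simp
  then obtain p q where pq: "p \<in> (\<lambda>x. x \<otimes> b) ` M \<inter> (\<lambda>x. x \<otimes> c) ` M"
    "q \<in> (\<lambda>x. x \<otimes> b) ` M \<inter> (\<lambda>x. x \<otimes> c) ` M" "p \<noteq> q"
    by (rule card_ge_2_obtain)
  have Mc: "M \<subseteq> carrier G" "finite M" using M criticalD by (auto simp: atom_def)
  from pq obtain y u z v where yuzv: "y \<in> M" "u \<in> M" "z \<in> M" "v \<in> M"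
    and p: "p = y \<otimes> b" "p = u \<otimes> c" and q: "q = z \<otimes> b" "q = v \<otimes> c" by blast
  then have cc: "y \<in> carrier G" "u \<in> carrier G" "z \<in> carrier G" "v \<in> carrier G"
    using Mc by auto
  define g where "g = y \<otimes> inv z"
  have g: "g \<in> carrier G" using cc by (simp add: g_def)
  have gz: "g \<otimes> z = y" using cc by (simp add: g_def m_assoc)
  have "p = g \<otimes> q" using p(1) q(1) gz g cc bc by (simp flip: m_assoc)
  then have "u \<otimes> c = (g \<otimes> v) \<otimes> c" using p(2) q(2) g cc bc by (simp add: m_assoc)
  then have gv: "g \<otimes> v = u" using cc bc g by simp
  \<comment> \<open>\<open>y = z\<close> would give \<open>p = q\<close>, and \<open>y = u\<close>
    would give \<open>b = c\<close>. So \<open>g\<close> is nontrivial and \<open>y\<close>,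
    \<open>u\<close> are two common points of \<open>M\<close> and \<open>gM\<close>.\<close>
  have "y \<noteq> z" using pq(3) p(1) q(1) by auto
  then have "g \<noteq> \<one>" using gz cc by auto
  have "y \<noteq> u" using p bc cc by auto
  moreover have "y \<in> M \<inter> (\<otimes>) g ` M" "u \<in> M \<inter> (\<otimes>) g ` M"
    using yuzv gz gv by auto
  ultimately have "2 \<le> card (M \<inter> (\<otimes>) g ` M)" using Mc(2) by (intro card_ge_2I[of _ y u]) auto
  with atom_l_translate[OF M g \<open>g \<noteq> \<one>\<close>] show False by simp
qed

text \<open>The right translates \<open>Mb\<close> with \<open>b\<close> in \<open>N\<close> lie in
  \<open>MN\<close>, of size \<open>|M| + |N| - 1\<close>, and pairwise share at most one point. Two
  of them need \<open>2|M| - 1\<close> points, which forces \<open>|N| = |M|\<close>; a third would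
  raise this to \<open>3|M| - 3\<close>, too many once \<open>|M| \<ge> 3\<close>.\<close>

lemma atom_card_eq_2:
  assumes M: "atom M Y" and MN: "critical M N" and le: "card N \<le> card M"
  shows "card M = 2"
proof -
  note c = criticalD[OF MN]
  define R where "R b = (\<lambda>x. x \<otimes> b) ` M" for b
  have fR: "finite (R b)" for b using c by (simp add: R_def)
  have cR: "card (R b) = card M" if "b \<in> N" for b
    using that c card_r_translate[of b M] by (auto simp: R_def)
  have iR: "card (R b \<inter> R d) \<le> 1" if "b \<in> N" "d \<in> N" "b \<noteq> d" for b d
    using that c atom_r_translate[OF M, of b d] by (auto simp: R_def)
  have subR: "R b \<subseteq> M <#> N" if "b \<in> N" for b
    using that by (auto simp: R_def set_mult_def)
  have fMN: "finite (M <#> N)" using c finite_set_mult by simp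
  obtain b d where bd: "b \<in> N" "d \<in> N" "b \<noteq> d" using card_ge_2_obtain[OF c(4)] .
  have U2: "card (R b \<union> R d) + 1 \<ge> 2 * card M"
    using card_Un_Int[OF fR fR, of b d] iR[OF bd] cR bd by simp
  have "card (R b \<union> R d) \<le> card (M <#> N)"
    using subR bd fMN by (intro card_mono) auto
  with U2 c(9) le have eq: "card N = card M" by linarith
  show ?thesis
  proof (rule ccontr)
    assume "card M \<noteq> 2"
    then have "card N \<ge> 3" using c(3) eq by simp
    then have "\<not> N \<subseteq> {b, d}" using card_mono[of "{b,d}" N] bd(3) by auto
    then obtain e where e: "e \<in> N" "e \<noteq> b" "e \<noteq> d" by blast
    have "card ((R b \<union> R d) \<inter> R e) \<le> card (R b \<inter> R e) + card (R d \<inter> R e)"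
      using card_Un_le[of "R b \<inter> R e" "R d \<inter> R e"] by (simp add: Int_Un_distrib2)
    also have "\<dots> \<le> 2" using iR[of b e] iR[of d e] bd e by auto
    finally have "card (R b \<union> R d \<union> R e) + 2 \<ge> card (R b \<union> R d) + card M"
      using card_Un_Int[of "R b \<union> R d" "R e"] fR cR[OF e(1)] by simp
    moreover have "card (R b \<union> R d \<union> R e) \<le> card (M <#> N)"
      using subR bd e fMN by (intro card_mono) auto
    ultimately show False using U2 c(9) eq \<open>card N \<ge> 3\<close> by linarith
  qed
qed

text \<open>\<open>M\<close> is an atom for \<open>Y\<close>, and \<open>N\<close> is the inverse of
  an atom \<open>K\<close> for the inverse of \<open>M\<close>. Then \<open>M N\<close> is critical
  and so is its mirror image, so \<open>atom_card_eq_2\<close> applies to whichever of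
  \<open>M\<close> and \<open>K\<close> is at least as large as the other.\<close>

lemma critical_pair_imp_doubleton:
  assumes "critical X Y"
  shows "\<exists>x\<in>carrier G. x \<noteq> \<one> \<and> critical {\<one>, x} Y"
proof -
  obtain M where M: "atom M Y" using atom_exists[OF assms] by blast
  then have MY: "critical M Y" by (simp add: atom_def)
  note c = criticalD[OF MY]
  obtain K where K: "atom K (m_inv G ` M)" using atom_exists[OF critical_inv[OF MY]] by blast
  define N where "N = m_inv G ` K"
  have KM: "critical K (m_inv G ` M)" using K by (simp add: atom_def)
  have MN: "critical M N"
    using critical_inv[OF KM] c(1) by (simp add: N_def inv_image_image)
  have cN: "card N = card K" using criticalD(1)[OF KM] by (simp add: N_def card_inv_image)
  have "card M = 2"
  proof (cases "card N \<le> card M")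
    case True
    then show ?thesis using atom_card_eq_2[OF M MN] by simp
  next
    \<comment> \<open>This case is contradictory: \<open>|K| = 2\<close> together with
      \<open>|M| < |N| = |K|\<close> leaves \<open>M\<close> with fewer than two points.\<close>
    case False
    then have "card (m_inv G ` M) \<le> card K" using cN c(1) by (simp add: card_inv_image)
    then have "card K = 2" using atom_card_eq_2[OF K KM] by simp
    then show ?thesis using False cN c(3) by simp
  qed
  then obtain a b where ab: "M = {a, b}" "a \<noteq> b" by (auto simp: card_2_iff)
  then have abc: "a \<in> carrier G" "b \<in> carrier G" using c(1) by auto
  \<comment> \<open>With this choice \<open>M\<close> is the left translate of
    \<open>{\<one>, x}\<close> by \<open>a\<close>, which changes no cardinality.\<close>
  define x where "x = inv a \<otimes> b"
  have x: "x \<in> carrier G" using abc by (simp add: x_def)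
  have ax: "a \<otimes> x = b" using abc by (simp add: x_def flip: m_assoc)
  then have x1: "x \<noteq> \<one>" using ab abc by auto
  have "M = (\<otimes>) a ` {\<one>, x}" using ab ax abc by auto
  then have "card (M <#> Y) = card ({\<one>, x} <#> Y)"
    using l_translate_set_mult[of a "{\<one>, x}" Y] card_l_translate[of a "{\<one>, x} <#> Y"]
      abc x c(2) set_mult_closed[of "{\<one>, x}" Y] by auto
  then have "critical {\<one>, x} Y"
    using MY x x1 \<open>card M = 2\<close> by (auto simp: critical_def)
  then show ?thesis using x x1 by blast
qed

section \<open>Progressions from critical pairs\<close>

text \<open>Since \<open>|Y \<union> xY| = |Y| + 1\<close>, exactly one point \<open>d\<close> of
  \<open>Y\<close> is not \<open>x\<close> times a point of \<open>Y\<close>. Dividing any point of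
  \<open>Y\<close> repeatedly by \<open>x\<close> must end at \<open>d\<close>, so \<open>Y\<close>
  is an unbroken run of powers of \<open>x\<close> applied to \<open>d\<close>.\<close>

lemma doubleton_critical_imp_progression:
  assumes crit: "critical {\<one>, x} Y" and x: "x \<noteq> \<one>"
  shows "\<exists>d\<in>carrier G. Y = (\<lambda>i. x [^] i \<otimes> d) ` {..<card Y}"
proof -
  note c = criticalD[OF crit]
  have xc: "x \<in> carrier G" using c(1) by simp
  define Z where "Z = (\<otimes>) x ` Y"
  have cZ: "card Z = card Y" using card_l_translate xc c(2) by (simp add: Z_def)
  have fZ: "finite Z" using c by (simp add: Z_def)
  have "{\<one>, x} <#> Y = Y \<union> Z"
    using c(2) by (force simp: Z_def set_mult_def image_iff)
  then have "card (Y \<union> Z) = card Y + 1" using c(9) x by simp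
  then have "card (Y - Z) = 1"
    using card_Un_Int[OF c(6) fZ] card_Diff_subset_Int[of Y Z] c(6) cZ by simp
  then obtain d where d: "Y - Z = {d}" by (auto simp: card_1_singleton_iff)
  then have dc: "d \<in> carrier G" "d \<in> Y" "d \<notin> Z" using c(2) by auto
  define I where "I = {i::nat. x [^] i \<otimes> d \<in> Y}"
  have inj: "inj (\<lambda>i::nat. x [^] i \<otimes> d)"
    using pow_inj[OF xc x] xc dc by (auto simp: inj_def)
  have pred: "\<exists>w\<in>Y. y = x \<otimes> w" if "y \<in> Y" "y \<noteq> d" for y
    using that d by (auto simp: Z_def)
  have YI: "y \<in> (\<lambda>i. x [^] i \<otimes> d) ` I" if y: "y \<in> Y" for y
  proof (rule ccontr)
    assume no: "y \<notin> (\<lambda>i. x [^] i \<otimes> d) ` I"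
    \<comment> \<open>By \<open>no\<close> the division by \<open>x\<close> never meets
      \<open>d\<close>, so it can go on forever inside \<open>Y\<close>; the quotients are pairwise
      distinct, against finiteness.\<close>
    have "\<exists>w\<in>Y. y = x [^] n \<otimes> w" for n :: nat
    proof (induction n)
      case 0
      have "y = x [^] (0::nat) \<otimes> y" using y c(2) by auto
      then show ?case using y by blast
    next
      case (Suc n)
      then obtain w where w: "w \<in> Y" "y = x [^] n \<otimes> w" by blast
      have "w \<noteq> d" using w no y by (auto simp: I_def)
      then obtain v where v: "v \<in> Y" "w = x \<otimes> v" using pred w by blast
      then have "y = x [^] Suc n \<otimes> v" using w xc c(2) by (auto simp: m_assoc)
      then show ?case using v by blast
    qed
    then obtain w where w: "\<And>n::nat. w n \<in> Y" "\<And>n::nat. y = x [^] n \<otimes> w n" by metis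
    have wc: "w n \<in> carrier G" for n using w c(2) by auto
    have "inj w"
    proof (rule injI)
      fix m n assume "w m = w n"
      then have "x [^] m \<otimes> w m = x [^] n \<otimes> w m" using w(2) by metis
      then have "x [^] m = x [^] n" using wc xc by simp
      then show "m = n" using pow_inj[OF xc x] by (auto dest: injD)
    qed
    then have "infinite (range w)" by (meson finite_imageD infinite_UNIV_nat)
    then show False using w(1) c(6) finite_subset[of "range w" Y] by blast
  qed
  have Yeq: "Y = (\<lambda>i. x [^] i \<otimes> d) ` I" using YI by (auto simp: I_def)
  \<comment> \<open>Injectivity separates \<open>x [^] Suc i \<otimes> d\<close> from
    \<open>d\<close>, so it has a predecessor in \<open>Y\<close>, which can only be
    \<open>x [^] i \<otimes> d\<close>.\<close>
  have down: "i \<in> I" if suc: "Suc i \<in> I" for i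
  proof -
    have "x [^] Suc i \<otimes> d \<noteq> x [^] (0::nat) \<otimes> d"
      using injD[OF inj, of "Suc i" 0] by blast
    then have "x [^] Suc i \<otimes> d \<noteq> d" using dc by simp
    then obtain w where w: "w \<in> Y" "x [^] Suc i \<otimes> d = x \<otimes> w" using pred[of "x [^] Suc i \<otimes> d"] suc unfolding I_def by blast
    have "x \<otimes> (x [^] i \<otimes> d) = x \<otimes> w"
      using w(2) xc dc by (simp only: nat_pow_Suc2 m_assoc nat_pow_closed)
    then have "x [^] i \<otimes> d = w" using w(1) xc dc c(2) by auto
    then show ?thesis using w by (simp add: I_def)
  qed
  have down': "i \<in> I" if "j \<in> I" "i \<le> j" for i j
    using that(2,1) by (induction rule: inc_induct) (auto intro: down)
  have cI: "card I = card Y" unfolding Yeq using inj by (simp add: card_image inj_on_def inj_def)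
  then have fI: "finite I" using c by (metis card.infinite not_numeral_le_zero)
  have "I = {..<card I}"
  proof -
    have "I \<subseteq> {..<card I}"
    proof
      fix i assume "i \<in> I"
      then have "{..i} \<subseteq> I" using down' by auto
      then have "Suc i \<le> card I" using card_mono[OF fI, of "{..i}"] by simp
      then show "i \<in> {..<card I}" by simp
    qed
    then show ?thesis using card_subset_eq[of "{..<card I}" I] by simp
  qed
  then have "Y = (\<lambda>i. x [^] i \<otimes> d) ` {..<card Y}" using Yeq cI by simp
  then show ?thesis using dc by blast
qed

text \<open>Write \<open>X = P{\<one>, z}\<close> with \<open>P\<close> one term shorter. Then
  \<open>XY = P({\<one>, z}Y)\<close>, and Kemperman for these two factors gives
  \<open>|{\<one>, z}Y| \<le> |Y| + 1\<close>, so \<open>{\<one>, z}\<close> and \<open>Y\<close>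
  form a critical pair.\<close>

lemma critical_progression_right:
  assumes crit: "critical X Y" and c: "c \<in> carrier G" and z: "z \<in> carrier G" "z \<noteq> \<one>"
    and X: "X = (\<lambda>i. c \<otimes> z [^] i) ` {..<card X}"
  shows "\<exists>d\<in>carrier G. Y = (\<lambda>i. z [^] i \<otimes> d) ` {..<card Y}"
proof -
  note cr = criticalD[OF crit]
  define n where "n = card X - 1"
  \<comment> \<open>\<open>n \<ge> 1\<close> keeps \<open>P\<close> nonempty, as Kemperman
    requires.\<close>
  have n: "card X = Suc n" "n \<ge> 1" using cr by (auto simp: n_def)
  define P where "P = (\<lambda>i. c \<otimes> z [^] i) ` {..<n}"
  have Pc: "P \<subseteq> carrier G" "finite P" "P \<noteq> {}" using c z n by (auto simp: P_def lessThan_empty_iff)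
  have cP: "card P = n"
    unfolding P_def using pow_inj[OF z] c z by (subst card_image) (auto simp: inj_on_def inj_def)
  have zc: "{\<one>, z} \<subseteq> carrier G" using z by simp
  have "P <#> {\<one>, z} = X"
  proof
    show "P <#> {\<one>, z} \<subseteq> X"
    proof
      fix y assume "y \<in> P <#> {\<one>, z}"
      then obtain i where i: "i < n" "y = c \<otimes> z [^] i \<or> y = c \<otimes> z [^] Suc i"
        using c z by (auto simp: P_def set_mult_def m_assoc)
      moreover have "c \<otimes> z [^] j \<in> X" if "j < Suc n" for j
        by (subst X) (use that n(1) in auto)
      ultimately show "y \<in> X" using less_SucI[of i n] Suc_mono[of i n] by blast
    qed
  next
    show "X \<subseteq> P <#> {\<one>, z}"
    proof
      fix y assume "y \<in> X"
      then have "y \<in> (\<lambda>i. c \<otimes> z [^] i) ` {..<card X}" using X by blast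
      then obtain i where i: "i < Suc n" "y = c \<otimes> z [^] i" using n(1) by auto
      show "y \<in> P <#> {\<one>, z}"
      proof (cases i)
        case 0
        then have "y = (c \<otimes> z [^] (0::nat)) \<otimes> \<one>" using i c by simp
        moreover have "c \<otimes> z [^] (0::nat) \<in> P" using n(2) unfolding P_def by (intro imageI) simp
        ultimately show ?thesis unfolding set_mult_iff by blast
      next
        case (Suc j)
        then have "y = (c \<otimes> z [^] j) \<otimes> z" "j < n" using i c z by (auto simp: m_assoc)
        then show ?thesis unfolding set_mult_iff P_def by blast
      qed
    qed
  qed
  then have "X <#> Y = P <#> ({\<one>, z} <#> Y)"
    using set_mult_assoc[OF Pc(1) zc cr(2)] by simp
  moreover have "card P + card ({\<one>, z} <#> Y) \<le> card (P <#> ({\<one>, z} <#> Y)) + 1"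
    using Pc zc cr by (intro kemperman set_mult_closed finite_set_mult set_mult_nonempty) auto
  moreover have "2 + card Y \<le> card ({\<one>, z} <#> Y) + 1"
    using kemperman[of "{\<one>, z}" Y] zc z cr by auto
  ultimately have "critical {\<one>, z} Y"
    using cr z n cP by (auto simp: critical_def)
  then show ?thesis using doubleton_critical_imp_progression z by blast
qed

lemma inv_progression:
  assumes "z \<in> carrier G" "d \<in> carrier G"
  shows "m_inv G ` (\<lambda>i. z [^] i \<otimes> d) ` {..<n::nat} = (\<lambda>i. inv d \<otimes> (inv z) [^] i) ` {..<n}"
  using assms by (auto simp: image_image inv_mult_group nat_pow_inv intro!: image_cong)

text \<open>The mirror image under inversion, which turns the ratio \<open>z\<close> into
  \<open>inv z\<close> and back.\<close>

lemma critical_progression_left: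
  assumes crit: "critical X Y" and d: "d \<in> carrier G" and z: "z \<in> carrier G" "z \<noteq> \<one>"
    and Y: "Y = (\<lambda>i. z [^] i \<otimes> d) ` {..<card Y}"
  shows "\<exists>c\<in>carrier G. X = (\<lambda>i. c \<otimes> z [^] i) ` {..<card X}"
proof -
  note cr = criticalD[OF crit]
  have "m_inv G ` Y = (\<lambda>i. inv d \<otimes> (inv z) [^] i) ` {..<card (m_inv G ` Y)}"
    unfolding card_inv_image[OF cr(2)] inv_progression[OF z(1) d, symmetric] using Y by simp
  moreover have "inv z \<noteq> \<one>" using z by (metis inv_inv inv_one)
  ultimately obtain e where e: "e \<in> carrier G"
    "m_inv G ` X = (\<lambda>i. (inv z) [^] i \<otimes> e) ` {..<card (m_inv G ` X)}"
    using critical_progression_right[OF critical_inv[OF crit], of "inv d" "inv z"] d z by auto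
  have "X = m_inv G ` m_inv G ` X" using cr(1) by (simp add: inv_image_image)
  also have "\<dots> = m_inv G ` (\<lambda>i. (inv z) [^] i \<otimes> e) ` {..<card X}"
    using e(2) cr(1) by (simp add: card_inv_image)
  also have "\<dots> = (\<lambda>i. inv e \<otimes> z [^] i) ` {..<card X}"
    using inv_progression[of "inv z" e "card X"] z e by simp
  finally show ?thesis using e(1) by blast
qed

section \<open>A common ratio along a chain of critical pairs\<close>

text \<open>With \<open>z = inv b \<otimes> g \<otimes> b\<close> the terms of \<open>X\<close> are
  \<open>(a \<otimes> b) \<otimes> z [^] i\<close>, so \<open>Y\<close> consists of terms
  \<open>z [^] i \<otimes> e\<close>, that is
  \<open>inv b \<otimes> g [^] i \<otimes> (b \<otimes> e)\<close>. Undoing the conjugation keeps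
  \<open>g\<close> and produces the left factor \<open>inv b\<close>.\<close>

lemma progression_step:
  assumes X: "geom_prog G X a g b" and abg: "a \<in> carrier G" "b \<in> carrier G" "g \<in> carrier G"
    and crit: "critical X Y"
  shows "\<exists>d\<in>carrier G. geom_prog G Y (inv b) g d"
proof -
  define z where "z = inv b \<otimes> g \<otimes> b"
  have z: "z \<in> carrier G" using abg by (simp add: z_def)
  have pow: "z [^] i = inv b \<otimes> g [^] i \<otimes> b" for i :: nat
  proof (induction i)
    case 0
    then show ?case using abg by simp
  next
    case (Suc i)
    have "b \<otimes> (inv b \<otimes> (g \<otimes> b)) = g \<otimes> b" using abg by (simp flip: m_assoc)
    then show ?case using Suc abg by (simp add: z_def m_assoc)
  qed
  have "b \<otimes> z = g \<otimes> b" using abg by (simp add: z_def flip: m_assoc)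
  then have "z \<noteq> \<one>" using X abg by (auto simp: geom_prog_def)
  have "a \<otimes> b \<otimes> z [^] i = a \<otimes> g [^] i \<otimes> b" for i :: nat
  proof -
    have "b \<otimes> (inv b \<otimes> (g [^] i \<otimes> b)) = g [^] i \<otimes> b" using abg by (simp flip: m_assoc)
    then show ?thesis using abg by (simp add: pow m_assoc)
  qed
  then have "X = (\<lambda>i. (a \<otimes> b) \<otimes> z [^] i) ` {..<card X}" using X by (simp add: geom_prog_def)
  then obtain e where e: "e \<in> carrier G" "Y = (\<lambda>i. z [^] i \<otimes> e) ` {..<card Y}"
    using critical_progression_right[OF crit _ z \<open>z \<noteq> \<one>\<close>, of "a \<otimes> b"] abg by auto
  have "z [^] i \<otimes> e = inv b \<otimes> g [^] i \<otimes> (b \<otimes> e)" for i :: nat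
    using abg e by (simp add: pow m_assoc)
  then have "geom_prog G Y (inv b) g (b \<otimes> e)"
    using X e criticalD[OF crit] by (simp add: geom_prog_def)
  then show ?thesis using abg e by blast
qed

text \<open>The ratio found for \<open>Y\<close> passes back to \<open>X\<close>. The right factor
  \<open>\<one>\<close> supplies the first \<open>\<beta>\<close> of the chain.\<close>

lemma critical_imp_geom_prog:
  assumes crit: "critical X Y"
  shows "\<exists>g\<in>carrier G. \<exists>a\<in>carrier G. geom_prog G X a g \<one>"
proof -
  obtain g where g: "g \<in> carrier G" "g \<noteq> \<one>" "critical {\<one>, g} Y"
    using critical_pair_imp_doubleton[OF crit] by blast
  then obtain d where d: "d \<in> carrier G" "Y = (\<lambda>i. g [^] i \<otimes> d) ` {..<card Y}"
    using doubleton_critical_imp_progression by blast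
  obtain c where c: "c \<in> carrier G" "X = (\<lambda>i. c \<otimes> g [^] i) ` {..<card X}"
    using critical_progression_left[OF crit d(1) g(1,2) d(2)] by blast
  then have "geom_prog G X c g \<one>"
    using g criticalD[OF crit] by (simp add: geom_prog_def)
  then show ?thesis using g c by blast
qed

lemma progression_chain:
  assumes crit: "\<And>j. 1 \<le> j \<Longrightarrow> j < k \<Longrightarrow> critical (B j) (B (Suc j))" and "2 \<le> k"
  shows "\<exists>g\<in>carrier G. g \<noteq> \<one> \<and>
           (\<exists>\<alpha> \<beta> :: nat \<Rightarrow> 'a.
              (\<forall>j\<in>{1..k}. \<alpha> j \<in> carrier G \<and> \<beta> j \<in> carrier G \<and> geom_prog G (B j) (\<alpha> j) g (\<beta> j))
            \<and> (\<forall>j\<in>{1..k-1}. \<alpha> (j+1) = inv (\<beta> j)))"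
proof -
  obtain g a where g: "g \<in> carrier G" and a: "a \<in> carrier G" "geom_prog G (B 1) a g \<one>"
    using critical_imp_geom_prog[OF crit[of 1]] \<open>2 \<le> k\<close> by auto
  \<comment> \<open>The ratio \<open>g\<close>, fixed at \<open>B 1\<close>, stays outside the
    induction; each step only extends \<open>\<alpha>\<close> and \<open>\<beta>\<close> by their
    values at \<open>Suc n\<close>.\<close>
  have "n \<le> k \<Longrightarrow> \<exists>\<alpha> \<beta> :: nat \<Rightarrow> 'a.
      (\<forall>j\<in>{1..n}. \<alpha> j \<in> carrier G \<and> \<beta> j \<in> carrier G \<and> geom_prog G (B j) (\<alpha> j) g (\<beta> j))
      \<and> (\<forall>j\<in>{1..n-1}. \<alpha> (j+1) = inv (\<beta> j))" if "1 \<le> n" for n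
    using that
  proof (induction n rule: dec_induct)
    case base
    have "{1..1::nat} = {1}" by auto
    then show ?case using a by (intro exI[of _ "\<lambda>_. a"] exI[of _ "\<lambda>_. \<one>"]) auto
  next
    case (step n)
    have "n \<le> k" using step.prems by simp
    from step.IH[OF this] obtain \<alpha> \<beta> :: "nat \<Rightarrow> 'a" where
      IH: "\<And>j. j \<in> {1..n} \<Longrightarrow> \<alpha> j \<in> carrier G \<and> \<beta> j \<in> carrier G \<and> geom_prog G (B j) (\<alpha> j) g (\<beta> j)"
        "\<And>j. j \<in> {1..n-1} \<Longrightarrow> \<alpha> (j+1) = inv (\<beta> j)"
      by blast
    have "critical (B n) (B (Suc n))" using crit step by simp
    then obtain d where d: "d \<in> carrier G" "geom_prog G (B (Suc n)) (inv (\<beta> n)) g d"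
      using progression_step[of "B n" "\<alpha> n" g "\<beta> n"] IH(1)[of n] g step(1) by auto
    let ?\<alpha> = "\<alpha>(Suc n := inv (\<beta> n))" and ?\<beta> = "\<beta>(Suc n := d)"
    have "?\<alpha> j \<in> carrier G \<and> ?\<beta> j \<in> carrier G \<and> geom_prog G (B j) (?\<alpha> j) g (?\<beta> j)"
      if "j \<in> {1..Suc n}" for j
      using that IH(1)[of j] IH(1)[of n] d step(1) by (cases "j = Suc n") auto
    moreover have "?\<alpha> (j+1) = inv (?\<beta> j)" if "j \<in> {1..Suc n - 1}" for j
      using that IH(2)[of j] by (cases "j = n") auto
    ultimately show ?case by blast
  qed
  then have "\<exists>\<alpha> \<beta> :: nat \<Rightarrow> 'a.
      (\<forall>j\<in>{1..k}. \<alpha> j \<in> carrier G \<and> \<beta> j \<in> carrier G \<and> geom_prog G (B j) (\<alpha> j) g (\<beta> j))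
      \<and> (\<forall>j\<in>{1..k-1}. \<alpha> (j+1) = inv (\<beta> j))" using \<open>2 \<le> k\<close> by simp
  moreover have "g \<noteq> \<one>" using a(2) by (simp add: geom_prog_def)
  ultimately show ?thesis using g by blast
qed

section \<open>Products of several sets\<close>

definition set_prod :: "'a set list \<Rightarrow> 'a set" where
  "set_prod Bs = foldr (set_mult G) Bs {\<one>}"

lemma set_prod_simps [simp]:
  "set_prod [] = {\<one>}" "set_prod (B # Bs) = B <#> set_prod Bs"
  by (simp_all add: set_prod_def)

lemma set_prod_closed: "(\<And>B. B \<in> set Bs \<Longrightarrow> B \<subseteq> carrier G) \<Longrightarrow> set_prod Bs \<subseteq> carrier G"
  by (induction Bs) (simp_all add: set_mult_closed)

lemma finite_set_prod: "(\<And>B. B \<in> set Bs \<Longrightarrow> finite B) \<Longrightarrow> finite (set_prod Bs)"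
  by (induction Bs) (auto intro!: finite_set_mult)

lemma set_prod_nonempty: "(\<And>B. B \<in> set Bs \<Longrightarrow> B \<noteq> {}) \<Longrightarrow> set_prod Bs \<noteq> {}"
  by (induction Bs) (auto simp: set_mult_nonempty)

lemma kemperman_list:
  assumes "\<And>B. B \<in> set Bs \<Longrightarrow> B \<subseteq> carrier G \<and> finite B \<and> B \<noteq> {}"
  shows "sum_list (map card Bs) + 1 \<le> card (set_prod Bs) + length Bs"
  using assms
proof (induction Bs)
  case (Cons B Bs)
  then have "card B + card (set_prod Bs) \<le> card (B <#> set_prod Bs) + 1"
    by (intro kemperman set_prod_closed finite_set_prod set_prod_nonempty) auto
  moreover have "sum_list (map card Bs) + 1 \<le> card (set_prod Bs) + length Bs"
    using Cons by simp
  ultimately show ?case by simp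
qed simp

text \<open>Merging two neighbours lets the bound for the shorter list see \<open>|XY|\<close> as
  the size of one factor.\<close>

lemma set_prod_merge:
  assumes "\<And>B. B \<in> set (us @ X # Y # vs) \<Longrightarrow> B \<subseteq> carrier G"
  shows "set_prod (us @ X # Y # vs) = set_prod (us @ (X <#> Y) # vs)"
  using assms
proof (induction us)
  case Nil
  then show ?case using set_mult_assoc[of X Y "set_prod vs"] set_prod_closed[of vs] by simp
qed simp

text \<open>The bound for the list with \<open>X\<close> and \<open>Y\<close> merged, compared with
  equality for the full list, leaves \<open>|XY| \<le> |X| + |Y| - 1\<close>; Kemperman gives the
  converse.\<close>

lemma kemperman_list_equality:
  assumes adm: "\<And>B. B \<in> set (us @ X # Y # vs) \<Longrightarrow> B \<subseteq> carrier G \<and> finite B \<and> B \<noteq> {}"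
    and eq: "card (set_prod (us @ X # Y # vs)) + length (us @ X # Y # vs)
        = sum_list (map card (us @ X # Y # vs)) + 1"
    and ge2: "2 \<le> card X" "2 \<le> card Y"
  shows "critical X Y"
proof -
  have XY: "X \<subseteq> carrier G" "finite X" "X \<noteq> {}" "Y \<subseteq> carrier G" "finite Y" "Y \<noteq> {}"
    using adm by auto
  have "sum_list (map card (us @ (X <#> Y) # vs)) + 1
      \<le> card (set_prod (us @ (X <#> Y) # vs)) + length (us @ (X <#> Y) # vs)"
  proof (rule kemperman_list)
    fix B assume "B \<in> set (us @ (X <#> Y) # vs)"
    then have "B = X <#> Y \<or> B \<in> set (us @ X # Y # vs)" by auto
    then show "B \<subseteq> carrier G \<and> finite B \<and> B \<noteq> {}"
      using adm[of B] set_mult_closed[OF XY(1,4)] finite_set_mult[OF XY(2,5)]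
        set_mult_nonempty[OF XY(3,6)] by metis
  qed
  moreover have "set_prod (us @ X # Y # vs) = set_prod (us @ (X <#> Y) # vs)"
    using set_prod_merge adm by blast
  moreover have "card X + card Y \<le> card (X <#> Y) + 1" by (rule kemperman[OF XY])
  ultimately show ?thesis using eq XY ge2 by (simp add: critical_def)
qed

lemma set_prodE:
  assumes "y \<in> set_prod Bs"
  obtains xs where "length xs = length Bs" "\<forall>j<length Bs. xs ! j \<in> Bs ! j" "y = list_prod G xs"
proof -
  have "\<exists>xs. length xs = length Bs \<and> (\<forall>j<length Bs. xs ! j \<in> Bs ! j) \<and> y = list_prod G xs"
    using assms
  proof (induction Bs arbitrary: y)
    case Nil
    then show ?case by (simp add: list_prod_def)
  next
    case (Cons B Bs)
    then obtain x w where xw: "x \<in> B" "w \<in> set_prod Bs" "y = x \<otimes> w" by (auto simp: set_mult_iff)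
    from Cons.IH[OF xw(2)] obtain xs where
      "length xs = length Bs" "\<forall>j<length Bs. xs ! j \<in> Bs ! j" "w = list_prod G xs" by blast
    then show ?case using xw
      by (intro exI[of _ "x # xs"]) (auto simp: list_prod_def nth_Cons split: nat.split)
  qed
  then show thesis using that by blast
qed

end

section \<open>Families of sets and multiplicities\<close>

text \<open>When \<open>x l\<close> is treated, \<open>l\<close> indices are taken but more than
  \<open>l\<close> are admissible, so one is still free.\<close>

lemma greedy_distinct_indices:
  assumes "finite I" "\<And>j. j < l \<Longrightarrow> j < card {i\<in>I. x j \<in> A i}"
  shows "\<exists>i::nat \<Rightarrow> 'b. inj_on i {..<l} \<and> i ` {..<l} \<subseteq> I \<and> (\<forall>j<l. x j \<in> A (i j))"
  using assms(2)
proof (induction l)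
  case (Suc l)
  then obtain i :: "nat \<Rightarrow> 'b"
    where i: "inj_on i {..<l}" "i ` {..<l} \<subseteq> I" "\<forall>j<l. x j \<in> A (i j)"
    by force
  have "card (i ` {..<l}) < card {i\<in>I. x l \<in> A i}"
    using Suc.prems[of l] card_image[OF i(1)] by simp
  then have "\<not> {i\<in>I. x l \<in> A i} \<subseteq> i ` {..<l}"
    using card_mono[of "i ` {..<l}" "{i\<in>I. x l \<in> A i}"] by auto
  then obtain h where h: "h \<in> I" "x l \<in> A h" "h \<notin> i ` {..<l}" by blast
  let ?i = "i(l := h)"
  have im: "?i ` {..<l} = i ` {..<l}" by (rule image_cong) auto
  have im': "?i ` {..<Suc l} = insert h (i ` {..<l})"
    unfolding lessThan_Suc image_insert im by simp
  have "inj_on ?i {..<l}" using i(1) by (auto simp: inj_on_def)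
  then have "inj_on ?i {..<Suc l}" unfolding lessThan_Suc inj_on_insert using h im by simp
  moreover have "?i ` {..<Suc l} \<subseteq> I" unfolding im' using h i by blast
  moreover have "\<forall>j<Suc l. x j \<in> A (?i j)" using h i by (auto simp: less_Suc_eq)
  ultimately show ?case by blast
qed simp

lemma finite_restricted_prod:
  assumes "\<And>i. i \<in> {1..m} \<Longrightarrow> finite (A i)"
  shows "finite (restricted_prod G l A m)"
proof -
  have "restricted_prod G l A m \<subseteq> list_prod G ` {xs. set xs \<subseteq> union_fam A m \<and> length xs = l}"
  proof
    fix y assume "y \<in> restricted_prod G l A m"
    then obtain x i where "y = list_prod G (map x [0..<l])" "i ` {..<l} \<subseteq> {1..m}"
      "\<forall>j<l. x j \<in> A (i j)" by (auto simp: restricted_prod_def)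
    moreover from this have "x j \<in> union_fam A m" if "j < l" for j
      using that unfolding union_fam_def by blast
    ultimately show "y \<in> list_prod G ` {xs. set xs \<subseteq> union_fam A m \<and> length xs = l}"
      by (intro image_eqI[of _ _ "map x [0..<l]"]) auto
  qed
  moreover have "finite (union_fam A m)" using assms by (auto simp: union_fam_def)
  ultimately show ?thesis using finite_subset finite_imageI[OF finite_lists_length_eq] by metis
qed

text \<open>Double counting: \<open>mult_fam l A m a\<close> is the number of thresholds
  \<open>j\<close> in \<open>{1..l}\<close> that it reaches.\<close>

lemma sum_mult_fam:
  assumes "finite (union_fam A m)"
  shows "(\<Sum>a\<in>union_fam A m. mult_fam l A m a)
    = (\<Sum>j\<in>{1..l}. card {a\<in>union_fam A m. j \<le> mult_fam l A m a})"
proof -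
  have "mult_fam l A m a = (\<Sum>j\<in>{1..l}. if j \<le> mult_fam l A m a then 1 else 0)" for a
  proof -
    have "mult_fam l A m a \<le> l" by (simp add: mult_fam_def)
    then have "{j \<in> {1..l}. j \<le> mult_fam l A m a} = {1..mult_fam l A m a}" by auto
    then show ?thesis by (simp flip: sum.inter_filter)
  qed
  then have "(\<Sum>a\<in>union_fam A m. mult_fam l A m a)
      = (\<Sum>a\<in>union_fam A m. \<Sum>j\<in>{1..l}. if j \<le> mult_fam l A m a then 1 else 0)"
    by (rule sum.cong[OF refl])
  also have "\<dots> = (\<Sum>j\<in>{1..l}. \<Sum>a\<in>union_fam A m. if j \<le> mult_fam l A m a then 1 else 0)"
    by (rule sum.swap)
  also have "\<dots> = (\<Sum>j\<in>{1..l}. card {a\<in>union_fam A m. j \<le> mult_fam l A m a})"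
    using assms by (intro sum.cong refl) (simp flip: sum.inter_filter)
  finally show ?thesis .
qed

section \<open>The level sets of \<open>mult_fam\<close> as a chain of critical pairs\<close>

theorem theorem1p18:
  fixes G :: "('a, 'b) monoid_scheme" and A :: "nat \<Rightarrow> 'a set" and l m k :: nat
  assumes "group G" and "torsion_free G"
    and "2 \<le> l" and "l < m"
    and "\<forall>i\<in>{1..m}. A i \<subseteq> carrier G \<and> finite (A i) \<and> 2 \<le> card (A i)"
    and "\<exists>a\<in>union_fam A m. mult_fam l A m a = l"
    and "2 \<le> card {a\<in>union_fam A m. 2 \<le> mult_fam l A m a}"
    and "int (card (restricted_prod G l A m))
           = (\<Sum>a\<in>union_fam A m. int (mult_fam l A m a)) - int l + 1"
    and "k = (GREATEST k. k \<le> l \<and> (\<forall>j\<in>{1..k}. 2 \<le> card {a\<in>union_fam A m. j \<le> mult_fam l A m a}))"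
  shows "\<exists>g\<in>carrier G. g \<noteq> \<one>\<^bsub>G\<^esub> \<and>
           (\<exists>\<alpha> \<beta> :: nat \<Rightarrow> 'a.
              (\<forall>j\<in>{1..k}. \<alpha> j \<in> carrier G \<and> \<beta> j \<in> carrier G \<and>
                 geom_prog G {a\<in>union_fam A m. j \<le> mult_fam l A m a} (\<alpha> j) g (\<beta> j))
            \<and> (\<forall>j\<in>{1..k-1}. \<alpha> (j+1) = inv\<^bsub>G\<^esub> (\<beta> j)))"
proof -
  interpret torsion_free_group G
    using assms(1,2) by (intro torsion_free_group.intro torsion_free_group_axioms.intro)
  define B where "B j = {a\<in>union_fam A m. j \<le> mult_fam l A m a}" for j
  define Bs where "Bs = map B [1..<Suc l]"
  have finU: "finite (union_fam A m)" and Uc: "union_fam A m \<subseteq> carrier G"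
    using assms(5) by (auto simp: union_fam_def)
  have B_antimono: "B j \<subseteq> B i" if "i \<le> j" for i j using that by (auto simp: B_def)
  \<comment> \<open>An element of multiplicity \<open>l\<close> lies in every \<open>B j\<close>
    with \<open>j \<le> l\<close>, so none of these is empty.\<close>
  have adm: "B j \<subseteq> carrier G \<and> finite (B j) \<and> B j \<noteq> {}" if "j \<le> l" for j
    using finU Uc assms(6) that by (auto simp: B_def)
  then have adms: "X \<subseteq> carrier G \<and> finite X \<and> X \<noteq> {}" if X: "X \<in> set Bs" for X
  proof -
    obtain j where "X = B j" "j \<le> l" using X by (auto simp: Bs_def)
    then show ?thesis using adm by blast
  qed
  have sub: "set_prod Bs \<subseteq> restricted_prod G l A m"
  proof
    fix y assume "y \<in> set_prod Bs"
    then obtain xs where xs: "length xs = length Bs" "\<forall>j<length Bs. xs ! j \<in> Bs ! j" "y = list_prod G xs"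
      by (rule set_prodE)
    have lenBs: "length Bs = l" by (simp add: Bs_def)
    \<comment> \<open>Position \<open>j\<close> of \<open>Bs\<close>, counted from 0, holds
      \<open>B (Suc j)\<close>, so \<open>xs ! j\<close> lies in at least \<open>j + 1\<close> of
      the sets, just what the greedy choice needs.\<close>
    have "j < card {i\<in>{1..m}. xs ! j \<in> A i}" if "j < l" for j
    proof -
      have "xs ! j \<in> B (Suc j)" using xs(2) that lenBs by (auto simp: Bs_def simp del: upt_Suc)
      then show ?thesis by (simp add: B_def mult_fam_def)
    qed
    then obtain i where "inj_on i {..<l}" "i ` {..<l} \<subseteq> {1..m}" "\<forall>j<l. xs ! j \<in> A (i j)"
      using greedy_distinct_indices[of "{1..m}" l "(!) xs" A] by auto
    moreover have "y = list_prod G (map ((!) xs) [0..<l])" using xs lenBs map_nth[of xs] by simp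
    ultimately show "y \<in> restricted_prod G l A m"
      unfolding restricted_prod_def by (intro CollectI exI[of _ "(!) xs"] exI[of _ i]) simp
  qed
  have "finite (restricted_prod G l A m)" using finite_restricted_prod assms(5) by blast
  then have "card (set_prod Bs) \<le> card (restricted_prod G l A m)" using sub by (rule card_mono)
  moreover have "sum_list (map card Bs) + 1 \<le> card (set_prod Bs) + length Bs"
    using adms by (rule kemperman_list)
  moreover have "sum_list (map card Bs) = (\<Sum>a\<in>union_fam A m. mult_fam l A m a)"
    unfolding sum_mult_fam[OF finU] B_def[symmetric]
    by (simp add: Bs_def interv_sum_list_conv_sum_set_nat o_def atLeastLessThanSuc_atLeastAtMost del: upt_Suc)
  moreover have "length Bs = l" by (simp add: Bs_def)
  \<comment> \<open>The hypothesis on \<open>restricted_prod\<close> turns the inclusion into an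
    upper bound that meets the Kemperman lower bound.\<close>
  ultimately have eq: "card (set_prod Bs) + length Bs = sum_list (map card Bs) + 1"
    using assms(8) by (simp flip: of_nat_sum)
  let ?P = "\<lambda>k. k \<le> l \<and> (\<forall>j\<in>{1..k}. 2 \<le> card (B j))"
  have k: "k = Greatest ?P" using assms(9) by (simp add: B_def)
  \<comment> \<open>The maximum exists because \<open>0\<close> qualifies and \<open>l\<close>
    bounds all candidates.\<close>
  have "?P 0" by simp
  then have Pk: "?P k" unfolding k by (rule GreatestI_nat[where b = l]) simp
  \<comment> \<open>\<open>k \<ge> 2\<close> provides the first critical pair, from which the ratio
    is taken.\<close>
  have "2 \<le> card (B 2)" using assms(7) by (simp add: B_def)
  moreover have "card (B 2) \<le> card (B 1)" using adm[of 1] B_antimono assms(3) by (intro card_mono) auto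
  ultimately have "?P 2" using assms(3) by (auto simp: numeral_2_eq_2 le_Suc_eq)
  then have k2: "2 \<le> k" unfolding k by (rule Greatest_le_nat[where b = l]) simp
  have "critical (B j) (B (Suc j))" if j: "1 \<le> j" "j < k" for j
  proof -
    \<comment> \<open>The list is split to expose the neighbours \<open>B j\<close> and
      \<open>B (Suc j)\<close>; both have two points because \<open>Suc j \<le> k\<close>.\<close>
    have "[1..<Suc l] = [1..<j] @ [j..<Suc l]" using upt_add_eq_append[of 1 j "Suc l - j"] j Pk by simp
    also have "[j..<Suc l] = j # Suc j # [Suc (Suc j)..<Suc l]"
      using j Pk by (simp add: upt_conv_Cons del: upt_Suc)
    finally have Bs: "Bs = map B [1..<j] @ B j # B (Suc j) # map B [Suc (Suc j)..<Suc l]"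
      by (simp add: Bs_def del: upt_Suc)
    show ?thesis
      using kemperman_list_equality[OF adms[unfolded Bs] eq[unfolded Bs]] Pk j by simp
  qed
  then show ?thesis using progression_chain[of k B] k2 unfolding B_def by blast
qed

end
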